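(* Let $1<\gamma<2$, let $F$ be the cumulative distribution function of a random variable taking positive integer values with probability $1$ such that $1-F(x)=L(x)x^{-\gamma}$ for all $x>0$, where $L$ is slowly varying at infinity. Let $D_1,\dots,D_n$ be the parity-corrected random degrees obtained from $n$ i.i.d. random variables with distribution $F$ (as defined in the context). Then for any $\delta$ such that $1<\delta<\gamma$, with probability $1-O(n^{1-\delta})$ as $n\to\infty$ there exists a simple graph on the vertex set $\{1,\dots,n\}$ in which vertex $i$ has degree $D_i$ for every $i=1,\dots,n$.
   Context: A function $L:(0,\infty)\to(0,\infty)$ is slowly varying (at infinity) if $\lim_{x\to\infty} L(tx)/L(x)=1$ for every fixed $t>0$. Random degrees: for each $n$, let $\xi_1,\dots,\xi_n$ be independent random variables with cumulative distribution function $F$. Put $D_i=\xi_i$ for $i<n$, and $D_n=\xi_n$ if $\sum_{i=1}^n\xi_i$ is even, $D_n=\xi_n+1$ if $\sum_{i=1}^n\xi_i$ is odd. A simple graph is an undirected graph without loops and multiple edges. The distribution $F$ and the parameter $\delta$ are fixed as $n\to\infty$; the constant implied by $O(\cdot)$ may depend on them but not on $n$. *)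

theory Defs
  imports "HOL-Probability.Probability" "HOL-Library.Landau_Symbols"
begin

(* Only the values of L on the positive half-line matter. *)
definition slowly_varying :: "(real \<Rightarrow> real) \<Rightarrow> bool" where
  "slowly_varying L \<longleftrightarrow>
     (\<forall>x>0. L x > 0) \<and> (\<forall>t>0. ((\<lambda>x. L (t * x) / L x) \<longlongrightarrow> 1) at_top)"

definition odd_integer :: "real \<Rightarrow> bool" where
  "odd_integer s \<longleftrightarrow> (\<exists>k::int. s = of_int k \<and> odd k)"

(* The sequence x is indexed by 1, ..., n.  If the sum is not an integer, which has
   probability 0 for integer-valued random variables, nothing is corrected. *)
definition parity_corrected :: "nat \<Rightarrow> (nat \<Rightarrow> real) \<Rightarrow> nat \<Rightarrow> real" where
  "parity_corrected n x i =
     (if i = n \<and> odd_integer (\<Sum>j=1..n. x j) then x i + 1 else x i)"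

(* An edge is a two-element set of vertices, so there are no loops and no multiple edges. *)
definition simple_graph :: "'v set \<Rightarrow> 'v set set \<Rightarrow> bool" where
  "simple_graph V E \<longleftrightarrow> (\<forall>e\<in>E. e \<subseteq> V \<and> card e = 2)"

definition vertex_degree :: "'v set set \<Rightarrow> 'v \<Rightarrow> nat" where
  "vertex_degree E v = card {e \<in> E. v \<in> e}"

(* The degrees are prescribed as real numbers because random variables are real-valued. *)
definition graphical :: "nat \<Rightarrow> (nat \<Rightarrow> real) \<Rightarrow> bool" where
  "graphical n d \<longleftrightarrow>
     (\<exists>E. simple_graph {1..n} E \<and> (\<forall>i\<in>{1..n}. real (vertex_degree E i) = d i))"

end

theory Submission
  imports Defs
begin

text \<open>The distribution has a finite moment of order \<open>\<delta>\<close> for every \<open>\<delta> < \<gamma>\<close>, since the ratio of the tail at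
  \<open>2x\<close> to the tail at \<open>x\<close> tends to \<open>2 powr (-\<gamma>)\<close> (\<open>integrable_powr_if_tail_doubling\<close>). Because
  \<open>\<delta> > 1\<close>, a constant \<open>a\<close> can be chosen for which the values above \<open>a\<close> contribute very little to the
  mean. The total of the values above \<open>a\<close> among \<open>n\<close> samples then stays below \<open>n / 8\<close> except with
  probability \<open>O(n powr (1 - \<delta>))\<close>: cut off at \<open>n\<close>, Markov's inequality controls the values above \<open>n\<close>
  and Chebyshev's inequality controls the sum of the others (\<open>large_summands_deviation\<close>). This
  order is natural, as a single value exceeding \<open>n\<close>, which rules out a graph, already has
  probability \<open>n powr (1 - \<gamma>)\<close> up to a slowly varying factor.

  The other half is deterministic: \<open>n\<close> positive integers with even sum are the degrees of a simple
  graph as soon as those above a fixed \<open>a\<close> sum to at most \<open>n / 4\<close> and \<open>n\<close> is large in terms of \<open>a\<close>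
  (\<open>realizable_if_few_large_degrees\<close>). Disjoint stars realize the large degrees, and among the
  graphs that do so and respect all prescribed bounds, one with the most edges realizes the rest:
  any remaining deficit could be reduced by adding an edge between unsaturated vertices or by
  exchanging an edge far from them. The parity correction changes
  one degree by one and is paid for by the factor between \<open>n / 8\<close> and \<open>n / 4\<close>.\<close>

section \<open>Simple graphs with few large prescribed degrees\<close>

lemma finite_simple_graph:
  assumes "finite V" "simple_graph V E"
  shows "finite E"
  using assms unfolding simple_graph_def by (meson PowI finite_Pow_iff finite_subset subsetI)

lemma handshake:
  assumes "finite V" "simple_graph V E"
  shows "(\<Sum>v\<in>V. vertex_degree E v) = 2 * card E"
  unfolding vertex_degree_def
proof (rule sum_multicount)
  show "\<forall>e\<in>E. card {v \<in> V. v \<in> e} = 2"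
  proof
    fix e assume "e \<in> E"
    then have "{v \<in> V. v \<in> e} = e" "card e = 2" using assms(2) unfolding simple_graph_def by auto
    then show "card {v \<in> V. v \<in> e} = 2" by simp
  qed
qed (use assms finite_simple_graph in auto)

lemma vertex_degree_insert:
  assumes "finite E" "e \<notin> E"
  shows "vertex_degree (insert e E) v = vertex_degree E v + of_bool (v \<in> e)"
proof -
  have "{f \<in> insert e E. v \<in> f} = (if v \<in> e then insert e {f \<in> E. v \<in> f} else {f \<in> E. v \<in> f})"
    by auto
  then show ?thesis using assms unfolding vertex_degree_def by auto
qed

text \<open>The edges at \<open>v\<close> correspond to their other endpoints, so the size of a neighbourhood is
  controlled by a degree. This counts the vertices that a switch at \<open>v\<close> has to avoid.\<close>
lemma card_neighbours:
  assumes "simple_graph V E" "finite E"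
  shows "card {w. {v, w} \<in> E} = vertex_degree E v" "finite {w. {v, w} \<in> E}"
proof -
  have "bij_betw (\<lambda>w. {v, w}) {w. {v, w} \<in> E} {e \<in> E. v \<in> e}"
    unfolding bij_betw_def
  proof
    show "inj_on (\<lambda>w. {v, w}) {w. {v, w} \<in> E}"
      by (auto simp: inj_on_def doubleton_eq_iff)
    show "(\<lambda>w. {v, w}) ` {w. {v, w} \<in> E} = {e \<in> E. v \<in> e}"
    proof
      show "{e \<in> E. v \<in> e} \<subseteq> (\<lambda>w. {v, w}) ` {w. {v, w} \<in> E}"
      proof
        fix e assume e: "e \<in> {e \<in> E. v \<in> e}"
        then obtain x y where "e = {x, y}" 
          using assms(1) unfolding simple_graph_def by (auto simp: card_2_iff)
        with e obtain w where "e = {v, w}" by auto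
        with e show "e \<in> (\<lambda>w. {v, w}) ` {w. {v, w} \<in> E}" by auto
      qed
    qed auto
  qed
  then show "card {w. {v, w} \<in> E} = vertex_degree E v" "finite {w. {v, w} \<in> E}"
    unfolding vertex_degree_def using assms(2) bij_betw_same_card bij_betw_finite by fastforce+
qed

lemma card_edges_meeting:
  assumes "finite S" 
  shows "card {e \<in> E. e \<inter> S \<noteq> {}} \<le> (\<Sum>v\<in>S. vertex_degree E v)"
proof -
  have "{e \<in> E. e \<inter> S \<noteq> {}} = (\<Union>v\<in>S. {e \<in> E. v \<in> e})" by auto
  then show ?thesis unfolding vertex_degree_def using card_UN_le[OF assms] by simp
qed

text \<open>The demands \<open>d h\<close> of the centres \<open>h \<in> H\<close> are laid injectively into the vertices outside
  \<open>H\<close>. Every vertex outside \<open>H\<close> is then used at most once, and it can bear one edge because its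
  prescribed degree is positive. This start takes care of all large degrees at once, however
  large they are; afterwards only vertices of bounded degree have to be completed.\<close>
lemma disjoint_stars:
  fixes d :: "'v \<Rightarrow> nat"
  assumes V: "finite V" and H: "H \<subseteq> V" and room: "(\<Sum>h\<in>H. d h) \<le> card (V - H)"
    and pos: "\<And>v. v \<in> V \<Longrightarrow> d v \<ge> 1"
  obtains E where "simple_graph V E" "\<And>h. h \<in> H \<Longrightarrow> vertex_degree E h = d h"
    "\<And>v. v \<in> V \<Longrightarrow> vertex_degree E v \<le> d v"
proof -
  let ?P = "Sigma H (\<lambda>h. {..<d h})"
  have fH: "finite H" using V H finite_subset by blast
  have "card ?P \<le> card (V - H)" using room fH by simp
  then obtain f where f: "f ` ?P \<subseteq> V - H" "inj_on f ?P"
    using card_le_inj[of ?P "V - H"] V fH by auto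
  define g where "g = (\<lambda>p. {fst p, f p})"
  have g_inj: "inj_on g ?P"
  proof (rule inj_onI)
    fix p q assume pq: "p \<in> ?P" "q \<in> ?P" "g p = g q"
    then have "fst p \<in> H" "fst q \<in> H" "f p \<notin> H" "f q \<notin> H" using f(1) by auto
    with pq(3) have "f p = f q" unfolding g_def by (auto simp: doubleton_eq_iff)
    then show "p = q" using pq f(2) by (auto dest: inj_onD)
  qed
  let ?E = "g ` ?P"
  have simple: "simple_graph V ?E"
    unfolding simple_graph_def
  proof
    fix e assume "e \<in> ?E"
    then obtain p where p: "p \<in> ?P" "e = g p" by auto
    then have "fst p \<in> H" "f p \<in> V - H" using f(1) by auto
    then have "fst p \<noteq> f p" by auto
    then show "e \<subseteq> V \<and> card e = 2"
      using p(2) H \<open>fst p \<in> H\<close> \<open>f p \<in> V - H\<close> by (auto simp: g_def)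
  qed
  have centre: "vertex_degree ?E h = d h" if "h \<in> H" for h
  proof -
    have "{e \<in> ?E. h \<in> e} = g ` ({h} \<times> {..<d h})"
    proof
      show "{e \<in> ?E. h \<in> e} \<subseteq> g ` ({h} \<times> {..<d h})"
      proof
        fix e assume "e \<in> {e \<in> ?E. h \<in> e}"
        then obtain p where p: "p \<in> ?P" "e = g p" "h \<in> g p" by auto
        then have "f p \<noteq> h" using f(1) that by auto
        then have "fst p = h" using p(3) by (auto simp: g_def)
        with p show "e \<in> g ` ({h} \<times> {..<d h})" by (auto intro!: imageI)
      qed
    qed (use that in \<open>auto simp: g_def\<close>)
    moreover have "inj_on g ({h} \<times> {..<d h})"
      using g_inj that by (auto elim!: inj_on_subset)
    ultimately show ?thesis unfolding vertex_degree_def by (simp add: card_image)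
  qed
  have leaf: "vertex_degree ?E v \<le> 1" if "v \<notin> H" for v
  proof -
    have "p = q" if "p \<in> ?P" "v \<in> g p" "q \<in> ?P" "v \<in> g q" for p q
    proof -
      have "f p = v" "f q = v" using that \<open>v \<notin> H\<close> by (auto simp: g_def)
      then show ?thesis using f(2) that by (auto dest: inj_onD)
    qed
    then have "e = e'" if "e \<in> {e \<in> ?E. v \<in> e}" "e' \<in> {e \<in> ?E. v \<in> e}" for e e'
      using that by (elim CollectE conjE imageE) metis
    moreover have "finite {e \<in> ?E. v \<in> e}" using fH by simp
    ultimately show ?thesis unfolding vertex_degree_def One_nat_def
      by (simp only: card_le_Suc0_iff_eq) blast
  qed
  show thesis
    by (rule that[OF simple centre]) (use leaf pos centre in \<open>metis order_refl order_trans\<close>)+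
qed

text \<open>The exchange step: \<open>u\<close> and \<open>v\<close> each gain one edge while \<open>x\<close> and \<open>y\<close> keep their degrees.
  The case \<open>u = v\<close> is included and raises the degree of \<open>u\<close> by two, which is how a single
  unsaturated vertex is treated.\<close>
lemma switching:
  assumes V: "finite V" and E: "simple_graph V E" and uv: "u \<in> V" "v \<in> V" and xy: "{x, y} \<in> E"
    and new: "{u, x} \<notin> E" "{v, y} \<notin> E" and dist: "x \<noteq> u" "x \<noteq> v" "y \<noteq> u" "y \<noteq> v"
  defines "E' \<equiv> insert {u, x} (insert {v, y} (E - {{x, y}}))"
  shows "simple_graph V E'" "card E' = card E + 1"
    "vertex_degree E' w = vertex_degree E w + of_bool (w = u) + of_bool (w = v)"
proof -
  have fin: "finite E" using V E finite_simple_graph by blast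
  have "x \<in> V" "y \<in> V" and ne: "x \<noteq> y" using E xy unfolding simple_graph_def by force+
  then show "simple_graph V E'"
    using E uv dist unfolding simple_graph_def E'_def by (auto simp: card_2_iff)
  have *: "{u, x} \<notin> insert {v, y} (E - {{x, y}})" "{v, y} \<notin> E - {{x, y}}"
    using new dist ne by (auto simp: doubleton_eq_iff)
  then show "card E' = card E + 1"
    unfolding E'_def using fin card.remove[OF fin xy] by simp
  have "vertex_degree E w = vertex_degree (E - {{x, y}}) w + of_bool (w \<in> {x, y})"
    using vertex_degree_insert[of "E - {{x, y}}" "{x, y}" w] fin unfolding insert_Diff[OF xy] by simp
  then show "vertex_degree E' w = vertex_degree E w + of_bool (w = u) + of_bool (w = v)"
    unfolding E'_def vertex_degree_insert[OF finite.insertI[OF finite_Diff[OF fin]] *(1)]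
      vertex_degree_insert[OF finite_Diff[OF fin] *(2)]
    using ne dist by (auto simp: of_bool_def)
qed

text \<open>Among the graphs that respect the bounds \<open>d\<close> and saturate the vertices of degree above \<open>a\<close>
  (there are some, by stars), one with the maximal number of edges realizes \<open>d\<close>. Otherwise its
  unsaturated vertices are pairwise adjacent, because a missing edge could be added; their degrees
  being less than \<open>a\<close>, there are at most \<open>a\<close> of them, and the graph lacks only \<open>O(a\<^sup>2)\<close> edges of the
  at least \<open>card V / 2\<close> demanded ones. By parity the total deficit is at least two, so there are
  \<open>u\<close> and \<open>v\<close>, possibly equal, that can gain an edge each. At most \<open>card V / 4 + O(a\<^sup>2)\<close> edges have
  an endpoint equal or adjacent to \<open>u\<close> or \<open>v\<close>: those through a vertex of large degree are at most
  \<open>card V / 4\<close>, and the others start from one of at most \<open>2a\<close> vertices of degree at most \<open>a\<close>. Hence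
  some edge \<open>{x, y}\<close> avoids all of these vertices, and switching it contradicts maximality.\<close>
lemma realizable_if_few_large_degrees:
  fixes d :: "'v \<Rightarrow> nat" and a :: nat
  assumes V: "finite V" and pos: "\<And>v. v \<in> V \<Longrightarrow> d v \<ge> 1" and even: "even (\<Sum>v\<in>V. d v)"
    and large: "4 * (\<Sum>v | v \<in> V \<and> d v > a. d v) \<le> card V" and big: "10 * a\<^sup>2 < card V"
  shows "\<exists>E. simple_graph V E \<and> (\<forall>v\<in>V. vertex_degree E v = d v)"
proof -
  define H where "H = {v \<in> V. d v > a}"
  define s where "s = (\<Sum>h\<in>H. d h)"
  have s: "4 * s \<le> card V" using large unfolding s_def H_def by simp
  have H: "H \<subseteq> V" "finite H" using V unfolding H_def by auto
  have "card H \<le> s"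
    unfolding s_def using sum_mono[of H "\<lambda>_. 1" d] pos H by fastforce
  then have "s \<le> card (V - H)" using s H V by (simp add: card_Diff_subset)
  then obtain E0 where E0: "simple_graph V E0" "\<And>h. h \<in> H \<Longrightarrow> vertex_degree E0 h = d h"
    "\<And>v. v \<in> V \<Longrightarrow> vertex_degree E0 v \<le> d v"
    using disjoint_stars[OF V H(1)] pos unfolding s_def by metis
  define P where "P E \<longleftrightarrow> simple_graph V E \<and> (\<forall>h\<in>H. vertex_degree E h = d h) \<and>
    (\<forall>v\<in>V. vertex_degree E v \<le> d v)" for E
  have "\<forall>E. P E \<longrightarrow> card E < Suc (card (Pow V))"
    using V by (auto simp: P_def simple_graph_def less_Suc_eq_le simp del: card_Pow intro!: card_mono)
  then obtain E where PE: "P E" and max: "\<And>E'. P E' \<Longrightarrow> card E' \<le> card E"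
    using ex_has_greatest_nat[of P E0 card "Suc (card (Pow V))"] E0 unfolding P_def by blast
  have E: "simple_graph V E" "\<And>h. h \<in> H \<Longrightarrow> vertex_degree E h = d h"
    "\<And>v. v \<in> V \<Longrightarrow> vertex_degree E v \<le> d v" using PE unfolding P_def by auto
  have fin: "finite E" using finite_simple_graph V E(1) .
  define D where "D = {v \<in> V. vertex_degree E v < d v}"
  have D: "D \<subseteq> V" "finite D" "D \<inter> H = {}" using V E(2) unfolding D_def by auto
  have D_light: "vertex_degree E v < a" if "v \<in> D" for v
    using that D(3) unfolding D_def H_def by force
  \<comment> \<open>A missing edge between unsaturated vertices could be added.\<close>
  have clique: "{u, v} \<in> E" if uv: "u \<in> D" "v \<in> D" "u \<noteq> v" for u v
  proof (rule ccontr)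
    assume new: "{u, v} \<notin> E"
    have "simple_graph V (insert {u, v} E)"
      using E(1) uv D(1) unfolding simple_graph_def by (auto simp: card_2_iff)
    moreover have "vertex_degree (insert {u, v} E) w = vertex_degree E w + of_bool (w \<in> {u, v})" for w
      using vertex_degree_insert[OF fin new] .
    ultimately have "P (insert {u, v} E)"
      unfolding P_def using uv E D(3) by (auto simp: D_def Suc_leI of_bool_def)
    then show False using max new fin by fastforce
  qed
  have "D = {}"
  proof (rule ccontr)
    assume "D \<noteq> {}"
    then obtain u0 where u0: "u0 \<in> D" by auto
    have "D - {u0} \<subseteq> {w. {u0, w} \<in> E}" using clique u0 by auto
    then have "card (D - {u0}) \<le> vertex_degree E u0"
      using card_neighbours[OF E(1) fin] card_mono by metis
    then have card_D: "card D \<le> a" using D_light[OF u0] u0 D(2) by simp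
    \<comment> \<open>By the handshake identity the total deficit is even and measures the missing edges.\<close>
    have deficit: "(\<Sum>v\<in>V. d v) = 2 * card E + (\<Sum>v\<in>D. d v - vertex_degree E v)"
    proof -
      have "(\<Sum>v\<in>V. d v) = (\<Sum>v\<in>V. vertex_degree E v + (d v - vertex_degree E v))"
        using E(3) by (intro sum.cong) auto
      also have "\<dots> = 2 * card E + (\<Sum>v\<in>V. d v - vertex_degree E v)"
        using handshake[OF V E(1)] by (simp add: sum.distrib)
      also have "(\<Sum>v\<in>V. d v - vertex_degree E v) = (\<Sum>v\<in>D. d v - vertex_degree E v)"
        using V by (intro sum.mono_neutral_right) (auto simp: D_def)
      finally show ?thesis .
    qed
    have "(\<Sum>v\<in>D. d v - vertex_degree E v) \<le> (\<Sum>v\<in>D. a)"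
      using D by (intro sum_mono) (force simp: H_def)
    also have "\<dots> \<le> a\<^sup>2" using card_D by (simp add: power2_eq_square)
    finally have "card V \<le> 2 * card E + a\<^sup>2"
      using deficit sum_mono[of V "\<lambda>_. 1" d] pos by fastforce
    then have many: "card E > 2 * a\<^sup>2 + s" using big s by linarith
    \<comment> \<open>A single unsaturated vertex lacks at least two edges, since the deficit is even.\<close>
    obtain u v where uv: "u \<in> D" "v \<in> D" "u = v \<longrightarrow> vertex_degree E u + 2 \<le> d u"
    proof (cases "D = {u0}")
      case True
      have "even (d u0 - vertex_degree E u0)" using deficit even True by (simp add: even_add) 
      moreover have "d u0 > vertex_degree E u0" using u0 unfolding D_def by simp
      ultimately have "vertex_degree E u0 + 2 \<le> d u0" by presburger
      then show ?thesis using that u0 by blast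
    next
      case False
      then show ?thesis using that u0 by blast
    qed
    \<comment> \<open>The forbidden endpoints: switching \<open>{x, y}\<close> requires that \<open>{u, x}\<close> and \<open>{v, y}\<close> be new edges.\<close>
    define S where "S = {u, v} \<union> {w. {u, w} \<in> E} \<union> {w. {v, w} \<in> E}"
    have finS: "finite S" unfolding S_def using card_neighbours(2)[OF E(1) fin] by simp
    have "card S \<le> card {u, v} + card {w. {u, w} \<in> E} + card {w. {v, w} \<in> E}"
      unfolding S_def by (meson card_Un_le add_mono order_refl order_trans)
    also have "\<dots> \<le> 2 + vertex_degree E u + vertex_degree E v"
      using card_neighbours(1)[OF E(1) fin] card_insert_le_m1[of 2 "{v}" u] by simp
    also have "\<dots> \<le> 2 * a" using D_light[OF uv(1)] D_light[OF uv(2)] by linarith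
    finally have card_S: "card S \<le> 2 * a" .
    have S_V: "S \<subseteq> V" using uv D(1) E(1) unfolding S_def simple_graph_def by auto
    have "card {e \<in> E. e \<inter> S \<noteq> {}} \<le> card ({e \<in> E. e \<inter> H \<noteq> {}} \<union> {e \<in> E. e \<inter> (S - H) \<noteq> {}})"
      using fin by (intro card_mono) auto
    also have "\<dots> \<le> (\<Sum>v\<in>H. vertex_degree E v) + (\<Sum>v\<in>S - H. vertex_degree E v)"
      using card_edges_meeting[of H E] card_edges_meeting[of "S - H" E] H finS
      by (intro order_trans[OF card_Un_le]) auto
    also have "(\<Sum>v\<in>H. vertex_degree E v) = s" unfolding s_def using E(2) by simp
    also have "(\<Sum>v\<in>S - H. vertex_degree E v) \<le> (\<Sum>v\<in>S - H. a)"
      by (intro sum_mono order_trans[OF E(3)]) (use S_V in \<open>auto simp: H_def\<close>)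
    also have "\<dots> \<le> 2 * a\<^sup>2"
      using card_S card_mono[OF finS, of "S - H"] by (simp add: power2_eq_square)
    finally have "card {e \<in> E. e \<inter> S \<noteq> {}} < card E" using many by simp
    then have "{e \<in> E. e \<inter> S \<noteq> {}} \<noteq> E" by (metis less_irrefl)
    then obtain e where e: "e \<in> E" "e \<inter> S = {}" by blast
    then obtain x y where xy: "e = {x, y}" 
      using E(1) unfolding simple_graph_def by (auto simp: card_2_iff)
    define E' where "E' = insert {u, x} (insert {v, y} (E - {{x, y}}))"
    have V': "u \<in> V" "v \<in> V" "{x, y} \<in> E" using uv D(1) e(1) xy by auto
    have "{u, x} \<notin> E" "{v, y} \<notin> E" "x \<noteq> u" "x \<noteq> v" "y \<noteq> u" "y \<noteq> v"
      using e(2) xy unfolding S_def by auto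
    note sw = switching[OF V E(1) V' this, folded E'_def]
    have "P E'"
      unfolding P_def using sw E D(3) uv by (auto simp: D_def of_bool_def Suc_leI)
    then show False using max sw(2) by fastforce
  qed
  then have "\<forall>v\<in>V. vertex_degree E v = d v"
    using E(3) unfolding D_def by force
  then show ?thesis using E(1) by blast
qed

text \<open>The correction only turns \<open>k\<close> into \<open>k + 1\<close> for one \<open>k \<ge> 1\<close>. A corrected degree above \<open>a + 1\<close>
  therefore comes from a value above \<open>a\<close> and is at most twice that value, so the factor \<open>8\<close> here
  becomes the factor \<open>4\<close> needed for the corrected degrees.\<close>
lemma graphical_parity_corrected:
  fixes x :: "nat \<Rightarrow> real" and a n :: nat
  assumes pos: "\<And>i. i \<in> {1..n} \<Longrightarrow> \<exists>k::nat. k \<ge> 1 \<and> x i = real k"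
    and large: "8 * (\<Sum>i=1..n. if x i > real a then x i else 0) \<le> real n"
    and big: "10 * (a + 1)\<^sup>2 < n"
  shows "graphical n (parity_corrected n x)"
proof -
  define k where "k i = nat \<lfloor>x i\<rfloor>" for i
  have k: "k i \<ge> 1" "x i = real (k i)" if "i \<in> {1..n}" for i
    using pos[OF that] unfolding k_def by auto
  define b where "b \<longleftrightarrow> odd (\<Sum>j=1..n. k j)"
  define d where "d i = k i + of_bool (i = n \<and> b)" for i
  have "(\<Sum>j=1..n. x j) = of_int (int (\<Sum>j=1..n. k j))" using k(2) by simp
  then have b: "odd_integer (\<Sum>j=1..n. x j) \<longleftrightarrow> b"
    unfolding odd_integer_def b_def by (metis even_of_nat of_int_eq_iff)
  have "(\<Sum>i=1..n. d i) = (\<Sum>i=1..n. k i) + (\<Sum>i=1..n. if i = n then of_bool b else 0)"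
    unfolding d_def sum.distrib by (intro arg_cong2[of _ _ _ _ "(+)"] sum.cong) auto
  also have "\<dots> = (\<Sum>i=1..n. k i) + of_bool b" using big by simp
  finally have even: "even (\<Sum>i=1..n. d i)" unfolding b_def by auto
  have dx: "real (d i) = parity_corrected n x i" if "i \<in> {1..n}" for i
    unfolding d_def parity_corrected_def b using k(2)[OF that] by auto
  have "4 * real (\<Sum>i | i \<in> {1..n} \<and> d i > a + 1. d i) = 
      4 * (\<Sum>i=1..n. if d i > a + 1 then real (d i) else 0)"
    unfolding of_nat_sum sum.inter_filter[OF finite_atLeastAtMost]
    by (intro arg_cong[of _ _ "(*) 4"] sum.cong) auto
  also have "\<dots> \<le> 4 * (\<Sum>i=1..n. 2 * (if x i > real a then x i else 0))"
  proof -
    have "(if d i > a + 1 then real (d i) else 0) \<le> 2 * (if x i > real a then x i else 0)"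
      if "i \<in> {1..n}" for i using k[OF that] unfolding d_def by auto
    then show ?thesis by (intro mult_left_mono sum_mono) auto
  qed
  also have "\<dots> \<le> real n" using large by (simp add: sum_distrib_left)
  finally have "real (4 * (\<Sum>i | i \<in> {1..n} \<and> d i > a + 1. d i)) \<le> real n" 
    by (simp only: of_nat_mult of_nat_numeral)
  then have "4 * (\<Sum>i | i \<in> {1..n} \<and> d i > a + 1. d i) \<le> card {1..n}"
    by (simp only: of_nat_le_iff card_atLeastAtMost diff_Suc_1)
  moreover have "d i \<ge> 1" if "i \<in> {1..n}" for i using k(1)[OF that] unfolding d_def by simp
  ultimately obtain E where "simple_graph {1..n} E" "\<forall>i\<in>{1..n}. vertex_degree E i = d i"
    using realizable_if_few_large_degrees[of "{1..n}" d "a + 1"] even big by auto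
  then show ?thesis unfolding graphical_def using dx by metis
qed

section \<open>Sums of independent variables with a moment of order between one and two\<close>

text \<open>Doubling the threshold multiplies the tail by at most \<open>q\<close> and the \<open>\<delta>\<close>-th power by
  \<open>2 powr \<delta>\<close>, so the dyadic layers \<open>2\<^sup>m x0 < X \<le> 2\<^sup>m\<^sup>+\<^sup>1 x0\<close> contribute to the moment at most the terms
  of a geometric series with ratio \<open>q * 2 powr \<delta> < 1\<close>. For a regularly varying tail this spares any
  uniform bound on the slowly varying factor: its behaviour at the ratio \<open>2\<close> is enough.\<close>
lemma (in prob_space) integrable_powr_if_tail_doubling:
  fixes X :: "'a \<Rightarrow> real" and q x0 \<delta> :: real
  assumes X [measurable]: "X \<in> borel_measurable M" and nonneg: "AE \<omega> in M. 0 \<le> X \<omega>"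
    and "0 < \<delta>" "0 < x0" "0 \<le> q" "q * 2 powr \<delta> < 1"
    and doubling: "\<And>x. x \<ge> x0 \<Longrightarrow> 
      prob {\<omega> \<in> space M. X \<omega> > 2 * x} \<le> q * prob {\<omega> \<in> space M. X \<omega> > x}"
  shows "integrable M (\<lambda>\<omega>. X \<omega> powr \<delta>)"
proof -
  define T where "T m = {\<omega> \<in> space M. X \<omega> > 2 ^ m * x0}" for m :: nat
  have T [measurable]: "T m \<in> events" for m unfolding T_def by measurable
  have prob_T: "prob (T m) \<le> q ^ m" for m
  proof (induction m)
    case (Suc m)
    have "x0 \<le> 2 ^ m * x0" using \<open>0 < x0\<close> by simp
    then have "prob (T (Suc m)) \<le> q * prob (T m)"
      using doubling[of "2 ^ m * x0"] by (simp add: T_def mult.assoc)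
    also have "\<dots> \<le> q * q ^ m" using Suc \<open>0 \<le> q\<close> by (intro mult_left_mono)
    finally show ?case by simp
  qed simp
  define c where "c m = (2 ^ Suc m * x0) powr \<delta>" for m
  have pointwise: "ennreal (X \<omega> powr \<delta>) \<le> ennreal (x0 powr \<delta>) + (\<Sum>m. ennreal (c m) * indicator (T m) \<omega>)"
    if "\<omega> \<in> space M" "0 \<le> X \<omega>" for \<omega>
  proof (cases "X \<omega> \<le> x0")
    case True
    then have "ennreal (X \<omega> powr \<delta>) \<le> ennreal (x0 powr \<delta>)"
      using that \<open>0 < \<delta>\<close> by (intro ennreal_leI powr_mono2) auto
    then show ?thesis by (simp add: add_increasing2)
  next
    case False
    obtain k where "X \<omega> / x0 < 2 ^ k" using real_arch_pow[of 2 "X \<omega> / x0"] by auto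
    then have "X \<omega> \<le> 2 ^ k * x0" using \<open>0 < x0\<close> by (simp add: field_simps)
    \<comment> \<open>The dyadic layer that contains \<open>X \<omega>\<close> is the one below the least admissible power.\<close>
    moreover define l where "l = (LEAST k. X \<omega> \<le> 2 ^ k * x0)"
    ultimately have l: "X \<omega> \<le> 2 ^ l * x0" "\<And>k. k < l \<Longrightarrow> 2 ^ k * x0 < X \<omega>"
      by (auto intro: LeastI dest: not_less_Least)
    have "l \<noteq> 0" using l(1) False by (intro notI) simp
    then obtain m where m: "l = Suc m" by (cases l) auto
    have "\<omega> \<in> T m" using l(2)[of m] m that by (simp add: T_def)
    moreover have "X \<omega> powr \<delta> \<le> c m"
      unfolding c_def using l(1) m that \<open>0 < \<delta>\<close> by (intro powr_mono2) auto
    ultimately have "ennreal (X \<omega> powr \<delta>) \<le> (\<Sum>j\<in>{m}. ennreal (c j) * indicator (T j) \<omega>)"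
      by (simp add: ennreal_leI)
    also have "\<dots> \<le> (\<Sum>j. ennreal (c j) * indicator (T j) \<omega>)"
      by (rule sum_le_suminf) auto
    finally show ?thesis by (simp add: add_increasing)
  qed
  have "(\<integral>\<^sup>+\<omega>. ennreal (X \<omega> powr \<delta>) \<partial>M) \<le> 
      (\<integral>\<^sup>+\<omega>. ennreal (x0 powr \<delta>) + (\<Sum>m. ennreal (c m) * indicator (T m) \<omega>) \<partial>M)"
    using nonneg by (intro nn_integral_mono_AE) (use pointwise in auto)
  also have "\<dots> = ennreal (x0 powr \<delta>) + (\<Sum>m. ennreal (c m) * emeasure M (T m))"
    by (subst nn_integral_add) 
      (auto simp: nn_integral_suminf nn_integral_cmult_indicator emeasure_space_1)
  also have "(\<Sum>m. ennreal (c m) * emeasure M (T m)) \<le> 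
      (\<Sum>m. ennreal ((2 * x0) powr \<delta> * (q * 2 powr \<delta>) ^ m))"
  proof (rule suminf_le)
    fix m
    have "c m = (2 * x0) powr \<delta> * (2 powr \<delta>) ^ m"
      using \<open>0 < x0\<close> unfolding c_def 
      by (simp add: powr_mult powr_powr mult_ac flip: powr_realpow)
    then have "c m * prob (T m) \<le> (2 * x0) powr \<delta> * (q * 2 powr \<delta>) ^ m"
      using prob_T[of m] by (simp add: power_mult_distrib mult_ac mult_right_mono mult_left_mono)
    then show "ennreal (c m) * emeasure M (T m) \<le> ennreal ((2 * x0) powr \<delta> * (q * 2 powr \<delta>) ^ m)"
      by (simp add: emeasure_eq_measure c_def ennreal_leI flip: ennreal_mult)
  qed auto
  finally have "(\<integral>\<^sup>+\<omega>. ennreal (X \<omega> powr \<delta>) \<partial>M) \<le> 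
      ennreal (x0 powr \<delta>) + (\<Sum>m. ennreal ((2 * x0) powr \<delta> * (q * 2 powr \<delta>) ^ m))" by simp
  also have "\<dots> < \<infinity>"
  proof -
    have "summable (\<lambda>m. (2 * x0) powr \<delta> * (q * 2 powr \<delta>) ^ m)"
      using assms by (intro summable_mult summable_geometric) auto
    then have "(\<Sum>m. ennreal ((2 * x0) powr \<delta> * (q * 2 powr \<delta>) ^ m)) \<noteq> top"
      using \<open>0 \<le> q\<close> by (intro ennreal_suminf_neq_top) auto
    then show ?thesis by (simp add: less_top)
  qed
  finally show ?thesis by (intro integrableI_bounded) auto
qed

text \<open>Chebyshev's inequality for independent bounded summands: the variance of the sum is at most
  \<open>card I * v\<close>, as the covariances vanish, and exceeding twice the bound \<open>m * card I\<close> of the mean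
  is a deviation by at least \<open>m * card I\<close>.\<close>
lemma (in prob_space) bounded_sum_deviation:
  fixes Y :: "'i \<Rightarrow> 'a \<Rightarrow> real" and b m v :: real
  assumes I: "finite I" "I \<noteq> {}" and indep: "indep_vars (\<lambda>_. borel) Y I"
    and bounded: "\<And>i \<omega>. i \<in> I \<Longrightarrow> \<bar>Y i \<omega>\<bar> \<le> b"
    and mean: "\<And>i. i \<in> I \<Longrightarrow> expectation (Y i) \<le> m" and "m > 0"
    and square: "\<And>i. i \<in> I \<Longrightarrow> expectation (\<lambda>\<omega>. (Y i \<omega>)\<^sup>2) \<le> v"
  shows "prob {\<omega> \<in> space M. (\<Sum>i\<in>I. Y i \<omega>) \<ge> 2 * m * card I} \<le> v / (card I * m\<^sup>2)"
proof -
  define Z where "Z i \<omega> = Y i \<omega> - expectation (Y i)" for i \<omega>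
  have Y [measurable]: "Y i \<in> borel_measurable M" if "i \<in> I" for i
    using indep that by (auto simp: indep_vars_def)
  have Y_int: "integrable M (Y i)" "integrable M (\<lambda>\<omega>. (Y i \<omega>)\<^sup>2)" if "i \<in> I" for i
  proof -
    show "integrable M (Y i)" 
      using bounded that by (intro integrable_const_bound[of _ b]) auto
    have "\<bar>Y i \<omega>\<bar>\<^sup>2 \<le> b\<^sup>2" for \<omega> using bounded[OF that] by (intro power_mono) auto
    then show "integrable M (\<lambda>\<omega>. (Y i \<omega>)\<^sup>2)"
      using that by (intro integrable_const_bound[of _ "b\<^sup>2"]) auto
  qed
  have Z_int: "integrable M (Z i)" and Z_mean: "expectation (Z i) = 0" if "i \<in> I" for i
    unfolding Z_def using Y_int(1)[OF that] by (auto simp: prob_space)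
  have Z_indep: "indep_vars (\<lambda>_. borel) Z I"
    unfolding Z_def[abs_def] by (rule indep_vars_compose2[OF indep]) auto
  have ZZ: "integrable M (\<lambda>\<omega>. Z i \<omega> * Z j \<omega>)"
    "expectation (\<lambda>\<omega>. Z i \<omega> * Z j \<omega>) \<le> (if i = j then v else 0)" if ij: "i \<in> I" "j \<in> I" for i j
  proof -
    have "integrable M (\<lambda>\<omega>. Z i \<omega> * Z j \<omega>) \<and> expectation (\<lambda>\<omega>. Z i \<omega> * Z j \<omega>) \<le> (if i = j then v else 0)"
    proof (cases "i = j")
      case True
      have "integrable M (\<lambda>\<omega>. (Z i \<omega>)\<^sup>2)"
        unfolding Z_def power2_diff using Y_int[OF ij(1)] by simp
      moreover have "expectation (\<lambda>\<omega>. (Z i \<omega>)\<^sup>2) \<le> v"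
        using variance_eq[OF Y_int[OF ij(1)]] square[OF ij(1)] zero_le_power2[of "expectation (Y i)"]
        unfolding Z_def by linarith
      ultimately show ?thesis using True by (simp add: power2_eq_square)
    next
      case False
      have "indep_vars (\<lambda>_. borel) Z {i, j}" using indep_vars_subset[OF Z_indep] ij by simp
      moreover have "integrable M (Z k)" if "k \<in> {i, j}" for k using that Z_int ij by auto
      ultimately have "integrable M (\<lambda>\<omega>. \<Prod>k\<in>{i, j}. Z k \<omega>)" 
        "expectation (\<lambda>\<omega>. \<Prod>k\<in>{i, j}. Z k \<omega>) = (\<Prod>k\<in>{i, j}. expectation (Z k))"
        using indep_vars_integrable[of "{i, j}" Z] indep_vars_lebesgue_integral[of "{i, j}" Z] by blast+
      then show ?thesis using False Z_mean ij by simp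
    qed
    then show "integrable M (\<lambda>\<omega>. Z i \<omega> * Z j \<omega>)"
      "expectation (\<lambda>\<omega>. Z i \<omega> * Z j \<omega>) \<le> (if i = j then v else 0)" by auto
  qed
  have sq: "(\<Sum>i\<in>I. Z i \<omega>)\<^sup>2 = (\<Sum>i\<in>I. \<Sum>j\<in>I. Z i \<omega> * Z j \<omega>)" for \<omega>
    by (simp add: power2_eq_square sum_product)
  have sq_int: "integrable M (\<lambda>\<omega>. (\<Sum>i\<in>I. Z i \<omega>)\<^sup>2)"
    unfolding sq using ZZ(1) by auto
  have "expectation (\<lambda>\<omega>. (\<Sum>i\<in>I. Z i \<omega>)\<^sup>2) = (\<Sum>i\<in>I. \<Sum>j\<in>I. expectation (\<lambda>\<omega>. Z i \<omega> * Z j \<omega>))"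
    unfolding sq using ZZ(1) by (simp add: Bochner_Integration.integral_sum)
  also have "\<dots> \<le> (\<Sum>i\<in>I. \<Sum>j\<in>I. if i = j then v else 0)"
    by (intro sum_mono ZZ(2))
  also have "\<dots> = card I * v" using I(1) by simp
  finally have var: "expectation (\<lambda>\<omega>. (\<Sum>i\<in>I. Z i \<omega>)\<^sup>2) \<le> card I * v" .
  have n: "card I > 0" using I by (simp add: card_gt_0_iff)
  have [measurable]: "(\<lambda>\<omega>. \<Sum>i\<in>I. Z i \<omega>) \<in> borel_measurable M" unfolding Z_def by measurable
  have "prob {\<omega> \<in> space M. (\<Sum>i\<in>I. Y i \<omega>) \<ge> 2 * m * card I} \<le>
      prob {\<omega> \<in> space M. (\<Sum>i\<in>I. Z i \<omega>)\<^sup>2 \<ge> (card I * m)\<^sup>2}"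
  proof (rule finite_measure_mono)
    have "(\<Sum>i\<in>I. expectation (Y i)) \<le> card I * m"
      using sum_mono[of I "\<lambda>i. expectation (Y i)" "\<lambda>_. m"] mean by simp
    then have "card I * m \<le> (\<Sum>i\<in>I. Z i \<omega>)" if "(\<Sum>i\<in>I. Y i \<omega>) \<ge> 2 * m * card I" for \<omega>
      using that unfolding Z_def sum_subtractf by (simp add: algebra_simps)
    then show "{\<omega> \<in> space M. (\<Sum>i\<in>I. Y i \<omega>) \<ge> 2 * m * card I} \<subseteq>
        {\<omega> \<in> space M. (\<Sum>i\<in>I. Z i \<omega>)\<^sup>2 \<ge> (card I * m)\<^sup>2}"
      using \<open>m > 0\<close> by (auto intro!: power_mono)
  qed measurable
  also have "\<dots> \<le> expectation (\<lambda>\<omega>. (\<Sum>i\<in>I. Z i \<omega>)\<^sup>2) / (card I * m)\<^sup>2"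
    using n \<open>m > 0\<close> by (intro integral_Markov_inequality_measure[OF sq_int, of "{}"]) auto
  also have "\<dots> \<le> card I * v / (card I * m)\<^sup>2"
    using var by (intro divide_right_mono) auto
  also have "\<dots> = v / (card I * m\<^sup>2)" using n by (simp add: power2_eq_square)
  finally show ?thesis .
qed

text \<open>The sum over the values above \<open>A\<close> is small with the polynomial error that a \<open>\<delta>\<close>-th moment
  allows. The truncation level is \<open>n = card I\<close>. By Markov's inequality some value exceeds \<open>n\<close> with
  probability at most \<open>n * K / n powr \<delta>\<close>. The values between \<open>A\<close> and \<open>n\<close> satisfy
  \<open>x \<le> A powr (1 - \<delta>) * x powr \<delta>\<close>, which makes their mean at most \<open>\<eta>\<close>, and
  \<open>x\<^sup>2 \<le> n powr (2 - \<delta>) * x powr \<delta>\<close>, which makes Chebyshev's bound of the order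
  \<open>n powr (1 - \<delta>)\<close> as well.\<close>
lemma (in prob_space) large_summands_deviation:
  fixes \<xi> :: "'i \<Rightarrow> 'a \<Rightarrow> real" and \<delta> A K \<eta> :: real
  assumes I: "finite I" "I \<noteq> {}" and indep: "indep_vars (\<lambda>_. borel) \<xi> I"
    and \<delta>: "1 \<le> \<delta>" "\<delta> \<le> 2" and "A > 0" "\<eta> > 0"
    and int: "\<And>i. i \<in> I \<Longrightarrow> integrable M (\<lambda>\<omega>. \<xi> i \<omega> powr \<delta>)"
    and moment: "\<And>i. i \<in> I \<Longrightarrow> expectation (\<lambda>\<omega>. \<xi> i \<omega> powr \<delta>) \<le> K"
    and A: "A powr (1 - \<delta>) * K \<le> \<eta>"
  shows "prob {\<omega> \<in> space M. (\<Sum>i\<in>I. if \<xi> i \<omega> > A then \<xi> i \<omega> else 0) \<ge> 2 * \<eta> * card I}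
     \<le> K * (1 + 1 / \<eta>\<^sup>2) * card I powr (1 - \<delta>)"
proof -
  define n where "n = real (card I)"
  have n: "n > 0" using I by (simp add: n_def card_gt_0_iff)
  have \<xi> [measurable]: "\<xi> i \<in> borel_measurable M" if "i \<in> I" for i
    using indep that by (auto simp: indep_vars_def)
  define h where "h x = (if A < x \<and> x \<le> n then x else 0)" for x
  have h_meas [measurable]: "h \<in> borel_measurable borel" unfolding h_def[abs_def] by measurable
  have h1: "h x \<le> A powr (1 - \<delta>) * x powr \<delta>" for x
  proof (cases "A < x \<and> x \<le> n")
    case True
    then have "x powr 1 \<le> A powr (1 - \<delta>) * x powr \<delta>" 
      using powr_mono2'[of "1 - \<delta>" A x] \<open>A > 0\<close> \<delta> 
      by (subst powr_add[of x "1 - \<delta>" \<delta>, simplified diff_add_cancel]) (simp add: mult_right_mono)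
    then show ?thesis using True \<open>A > 0\<close> by (simp add: h_def)
  qed (auto simp: h_def)
  have h2: "(h x)\<^sup>2 \<le> n powr (2 - \<delta>) * x powr \<delta>" for x
  proof (cases "A < x \<and> x \<le> n")
    case True
    then have "x powr 2 \<le> n powr (2 - \<delta>) * x powr \<delta>" 
      using powr_mono2[of "2 - \<delta>" x n] \<open>A > 0\<close> \<delta> 
      by (subst powr_add[of x "2 - \<delta>" \<delta>, simplified diff_add_cancel]) (simp add: mult_right_mono)
    then show ?thesis using True \<open>A > 0\<close> by (simp add: h_def)
  qed (auto simp: h_def)
  have h_bound: "\<bar>h x\<bar> \<le> n" for x using \<open>A > 0\<close> n by (auto simp: h_def)
  have h_sq: "(h x)\<^sup>2 \<le> n\<^sup>2" for x using power_mono[OF h_bound, of x 2] by simp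
  have Y_int: "integrable M (\<lambda>\<omega>. h (\<xi> i \<omega>))" "integrable M (\<lambda>\<omega>. (h (\<xi> i \<omega>))\<^sup>2)" if "i \<in> I" for i
  proof -
    show "integrable M (\<lambda>\<omega>. h (\<xi> i \<omega>))"
      using h_bound that by (intro integrable_const_bound[of _ n]) auto
    show "integrable M (\<lambda>\<omega>. (h (\<xi> i \<omega>))\<^sup>2)"
      using h_sq that by (intro integrable_const_bound[of _ "n\<^sup>2"]) auto
  qed
  have mean: "expectation (\<lambda>\<omega>. h (\<xi> i \<omega>)) \<le> \<eta>" if "i \<in> I" for i
  proof -
    have "expectation (\<lambda>\<omega>. h (\<xi> i \<omega>)) \<le> expectation (\<lambda>\<omega>. A powr (1 - \<delta>) * \<xi> i \<omega> powr \<delta>)"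
      using Y_int int that h1 by (intro integral_mono) auto
    also have "\<dots> \<le> A powr (1 - \<delta>) * K" using moment[OF that] by (simp add: mult_left_mono)
    finally show ?thesis using A by simp
  qed
  have square: "expectation (\<lambda>\<omega>. (h (\<xi> i \<omega>))\<^sup>2) \<le> n powr (2 - \<delta>) * K" if "i \<in> I" for i
  proof -
    have "expectation (\<lambda>\<omega>. (h (\<xi> i \<omega>))\<^sup>2) \<le> expectation (\<lambda>\<omega>. n powr (2 - \<delta>) * \<xi> i \<omega> powr \<delta>)"
      using Y_int int that h2 by (intro integral_mono) auto
    also have "\<dots> \<le> n powr (2 - \<delta>) * K" using moment[OF that] by (simp add: mult_left_mono)
    finally show ?thesis .
  qed
  define B where "B i = {\<omega> \<in> space M. \<xi> i \<omega> > n}" for i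
  define C where "C = {\<omega> \<in> space M. (\<Sum>i\<in>I. h (\<xi> i \<omega>)) \<ge> 2 * \<eta> * card I}"
  have meas: "B i \<in> events" if "i \<in> I" for i unfolding B_def using that by measurable
  have meas_C: "C \<in> events" unfolding C_def by measurable
  have C: "prob C \<le> n powr (2 - \<delta>) * K / (card I * \<eta>\<^sup>2)"
    unfolding C_def
  proof (rule bounded_sum_deviation[OF I _ _ _ \<open>\<eta> > 0\<close>])
    show "indep_vars (\<lambda>_. borel) (\<lambda>i \<omega>. h (\<xi> i \<omega>)) I"
      by (rule indep_vars_compose2[OF indep]) simp
  qed (use h_bound mean square in auto)
  have B: "prob (B i) \<le> K * n powr (-\<delta>)" if "i \<in> I" for i
  proof -
    have "prob (B i) \<le> prob {\<omega> \<in> space M. \<xi> i \<omega> powr \<delta> \<ge> n powr \<delta>}"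
      unfolding B_def using that n \<delta> by (intro finite_measure_mono) (auto intro!: powr_mono2)
    also have "\<dots> \<le> expectation (\<lambda>\<omega>. \<xi> i \<omega> powr \<delta>) / n powr \<delta>"
      using n by (intro integral_Markov_inequality_measure[OF int[OF that], of "{}"]) auto
    also have "\<dots> \<le> K / n powr \<delta>" using moment[OF that] by (intro divide_right_mono) auto
    finally show ?thesis by (simp add: powr_minus_divide)
  qed
  have "{\<omega> \<in> space M. (\<Sum>i\<in>I. if \<xi> i \<omega> > A then \<xi> i \<omega> else 0) \<ge> 2 * \<eta> * card I} \<subseteq> C \<union> (\<Union>i\<in>I. B i)"
  proof
    fix \<omega> assume \<omega>: "\<omega> \<in> {\<omega> \<in> space M. (\<Sum>i\<in>I. if \<xi> i \<omega> > A then \<xi> i \<omega> else 0) \<ge> 2 * \<eta> * card I}"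
    show "\<omega> \<in> C \<union> (\<Union>i\<in>I. B i)"
    proof (cases "\<omega> \<in> (\<Union>i\<in>I. B i)")
      case False
      then have "\<xi> i \<omega> \<le> n" if "i \<in> I" for i using that \<omega> by (force simp: B_def)
      then have "(\<Sum>i\<in>I. h (\<xi> i \<omega>)) = (\<Sum>i\<in>I. if \<xi> i \<omega> > A then \<xi> i \<omega> else 0)"
        by (intro sum.cong) (auto simp: h_def)
      then show ?thesis using \<omega> by (simp add: C_def)
    qed simp
  qed
  then have "prob {\<omega> \<in> space M. (\<Sum>i\<in>I. if \<xi> i \<omega> > A then \<xi> i \<omega> else 0) \<ge> 2 * \<eta> * card I} \<le>
      prob (C \<union> (\<Union>i\<in>I. B i))"
    by (rule finite_measure_mono) (intro sets.Un meas_C sets.finite_UN I(1) meas)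
  also have "\<dots> \<le> prob C + prob (\<Union>i\<in>I. B i)"
    using I meas meas_C by (intro measure_Un_le) auto
  also have "prob (\<Union>i\<in>I. B i) \<le> (\<Sum>i\<in>I. prob (B i))"
    using I meas by (intro finite_measure_subadditive_finite) auto
  also have "\<dots> \<le> (\<Sum>i\<in>I. K * n powr (-\<delta>))" by (intro sum_mono B)
  also have "\<dots> = K * (n * n powr (-\<delta>))" by (simp add: n_def)
  also have "n * n powr (-\<delta>) = n powr (1 - \<delta>)" using n by (simp add: powr_mult_base)
  also note C
  also have "n powr (2 - \<delta>) = n * n powr (1 - \<delta>)" using n by (simp add: powr_mult_base)
  also have "n * n powr (1 - \<delta>) * K / (card I * \<eta>\<^sup>2) = K / \<eta>\<^sup>2 * n powr (1 - \<delta>)"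
    using n by (simp flip: n_def)
  finally show ?thesis by (simp add: algebra_simps n_def)
qed

text \<open>On a fixed vertex set there are only finitely many graphs, and each prescribes the corrected
  degrees exactly. Measurability is what gives the probability in the theorem its meaning: a
  lower bound by monotonicity needs the larger event to be measurable.\<close>
lemma sets_graphical_parity_corrected:
  assumes \<xi>: "\<And>i. i \<in> {1..n} \<Longrightarrow> \<xi> i \<in> borel_measurable M"
  shows "{\<omega> \<in> space M. graphical n (parity_corrected n (\<lambda>i. \<xi> i \<omega>))} \<in> sets M"
proof -
  have odd [measurable]: "Measurable.pred borel odd_integer"
    unfolding odd_integer_def[abs_def] by measurable
  have S [measurable]: "(\<lambda>\<omega>. \<Sum>j=1..n. \<xi> j \<omega>) \<in> borel_measurable M"
    by (intro borel_measurable_sum \<xi>)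
  have "{\<omega> \<in> space M. graphical n (parity_corrected n (\<lambda>i. \<xi> i \<omega>))} =
    (\<Union>E\<in>{E \<in> Pow (Pow {1..n}). simple_graph {1..n} E}.
      {\<omega> \<in> space M. \<forall>i\<in>{1..n}. real (vertex_degree E i) = parity_corrected n (\<lambda>i. \<xi> i \<omega>) i})"
    by (auto simp: graphical_def simple_graph_def)
  also have "\<dots> \<in> sets M"
  proof (rule sets.finite_UN)
    fix E
    have "{\<omega> \<in> space M. real (vertex_degree E i) = parity_corrected n (\<lambda>i. \<xi> i \<omega>) i} \<in> sets M"
      if "i \<in> {1..n}" for i
      using \<xi>[OF that] S odd unfolding parity_corrected_def by measurable
    then show "{\<omega> \<in> space M. \<forall>i\<in>{1..n}. real (vertex_degree E i) = parity_corrected n (\<lambda>i. \<xi> i \<omega>) i} \<in> sets M"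
      by (intro sets.sets_Collect_finite_All) auto
  qed auto
  finally show ?thesis .
qed

section \<open>Random degree sequences\<close>

theorem theorem1:
  fixes \<gamma> \<delta> :: real
    and F L :: "real \<Rightarrow> real"
    and N :: "'b measure" and X :: "'b \<Rightarrow> real"
    and M :: "nat \<Rightarrow> 'a measure" and \<xi> :: "nat \<Rightarrow> nat \<Rightarrow> 'a \<Rightarrow> real"
  assumes gamma: "1 < \<gamma>" "\<gamma> < 2"
    and X_space: "prob_space N"
    and X_rv: "X \<in> borel_measurable N"
    and X_pos_int: "AE \<omega> in N. \<exists>k::nat. k \<ge> 1 \<and> X \<omega> = real k"
    and X_cdf: "F = cdf (distr N borel X)"
    and slow: "slowly_varying L"
    and tail: "\<And>x. x > 0 \<Longrightarrow> 1 - F x = L x * x powr (- \<gamma>)"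
    and xi_space: "\<And>n. n \<ge> 1 \<Longrightarrow> prob_space (M n)"
    and xi_rv: "\<And>n i. n \<ge> 1 \<Longrightarrow> i \<in> {1..n} \<Longrightarrow> \<xi> n i \<in> borel_measurable (M n)"
    and xi_indep: "\<And>n. n \<ge> 1 \<Longrightarrow> prob_space.indep_vars (M n) (\<lambda>_. borel) (\<xi> n) {1..n}"
    and xi_cdf: "\<And>n i. n \<ge> 1 \<Longrightarrow> i \<in> {1..n} \<Longrightarrow> cdf (distr (M n) borel (\<xi> n i)) = F"
    and delta: "1 < \<delta>" "\<delta> < \<gamma>"
  shows "(\<lambda>n. 1 - measure (M n)
            {\<omega> \<in> space (M n). graphical n (parity_corrected n (\<lambda>i. \<xi> n i \<omega>))})
         \<in> O(\<lambda>n. real n powr (1 - \<delta>))"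
proof -
  interpret N: prob_space N by (rule X_space)
  \<comment> \<open>Any exponent strictly between \<open>\<delta>\<close> and \<open>\<gamma>\<close> will do: the gap to \<open>\<gamma>\<close> absorbs the slowly
      varying factor, the gap to \<open>\<delta>\<close> makes the geometric series of the moment converge.\<close>
  define \<beta> where "\<beta> = (\<gamma> + \<delta>) / 2"
  have \<beta>: "\<delta> < \<beta>" "\<beta> < \<gamma>" using delta by (auto simp: \<beta>_def)
  have X_tail: "N.prob {\<omega> \<in> space N. X \<omega> > x} = 1 - F x" for x
  proof -
    have "F x = N.prob {\<omega> \<in> space N. X \<omega> \<le> x}"
      using X_rv unfolding X_cdf cdf_def by (subst measure_distr) (auto intro!: arg_cong[of _ _ N.prob])
    moreover have "{\<omega> \<in> space N. X \<omega> > x} = space N - {\<omega> \<in> space N. X \<omega> \<le> x}" by auto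
    ultimately show ?thesis using X_rv by (simp add: N.prob_compl)
  qed
  have "((\<lambda>x. L (2 * x) / L x) \<longlongrightarrow> 1) at_top" using slow by (simp add: slowly_varying_def)
  then have "eventually (\<lambda>x. L (2 * x) / L x < 2 powr (\<gamma> - \<beta>)) at_top"
    using \<beta> by (intro order_tendstoD) auto
  then obtain x1 where x1: "\<And>x. x \<ge> x1 \<Longrightarrow> L (2 * x) / L x < 2 powr (\<gamma> - \<beta>)"
    by (auto simp: eventually_at_top_linorder)
  have doubling: "1 - F (2 * x) \<le> 2 powr (- \<beta>) * (1 - F x)" if "x \<ge> max 1 x1" for x
  proof -
    have "x > 0" "L x > 0" using that slow by (auto simp: slowly_varying_def)
    then have "L (2 * x) \<le> 2 powr (\<gamma> - \<beta>) * L x" using x1[of x] that by (simp add: field_simps)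
    then have "L (2 * x) * (2 * x) powr (- \<gamma>) \<le> 2 powr (\<gamma> - \<beta>) * L x * (2 * x) powr (- \<gamma>)"
      by (rule mult_right_mono) simp
    also have "\<dots> = (2 powr (\<gamma> - \<beta>) * 2 powr (- \<gamma>)) * (L x * x powr (- \<gamma>))"
      using \<open>x > 0\<close> by (simp add: powr_mult)
    also have "2 powr (\<gamma> - \<beta>) * 2 powr (- \<gamma>) = 2 powr (- \<beta>)" by (simp flip: powr_add)
    finally show ?thesis using tail[of x] tail[of "2 * x"] \<open>x > 0\<close> by simp
  qed
  have X_int: "integrable N (\<lambda>\<omega>. X \<omega> powr \<delta>)"
  proof (rule N.integrable_powr_if_tail_doubling[where q = "2 powr (- \<beta>)" and ?x0.0 = "max 1 x1"])
    show "2 powr (- \<beta>) * 2 powr \<delta> < 1"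
      using \<beta> powr_less_mono[of "\<delta> - \<beta>" 0 2] by (simp flip: powr_add)
    show "AE \<omega> in N. 0 \<le> X \<omega>" using X_pos_int by eventually_elim auto
  qed (use X_rv delta doubling X_tail in auto)
  define K where "K = N.expectation (\<lambda>\<omega>. X \<omega> powr \<delta>)"
  have same_distr: "distr (M n) borel (\<xi> n i) = distr N borel X" if "n \<ge> 1" "i \<in> {1..n}" for n i
  proof (rule cdf_unique)
    show "real_distribution (distr (M n) borel (\<xi> n i))"
      using prob_space.real_distribution_distr[OF xi_space xi_rv] that by blast
    show "real_distribution (distr N borel X)" using X_rv by (rule N.real_distribution_distr)
    show "cdf (distr (M n) borel (\<xi> n i)) = cdf (distr N borel X)" using xi_cdf that X_cdf by simp
  qed
  \<comment> \<open>The threshold \<open>a\<close> for large degrees. With \<open>\<eta> = 1 / 16\<close> the values above \<open>a\<close> have sum at most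
      \<open>n / 8\<close> outside the exceptional event, as the graph construction requires.\<close>
  have "(\<lambda>a. real a powr (1 - \<delta>) * K) \<longlonglongrightarrow> 0"
    using delta by (intro tendsto_mult_left_zero tendsto_neg_powr filterlim_real_sequentially) auto
  then have "eventually (\<lambda>a. real a powr (1 - \<delta>) * K < 1 / 16) sequentially"
    by (rule order_tendstoD) simp
  then obtain a where a: "a \<ge> 1" "real a powr (1 - \<delta>) * K < 1 / 16"
    unfolding eventually_sequentially by (meson max.cobounded1 max.cobounded2)
  have bound: "norm (1 - measure (M n) {\<omega> \<in> space (M n). graphical n (parity_corrected n (\<lambda>i. \<xi> n i \<omega>))})
      \<le> (K * 257) * norm (real n powr (1 - \<delta>))" if n: "n > 10 * (a + 1)\<^sup>2" for n
  proof -
    have "n \<ge> 1" using n by simp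
    interpret prob_space "M n" using xi_space \<open>n \<ge> 1\<close> .
    have \<xi> [measurable]: "\<xi> n i \<in> borel_measurable (M n)" if "i \<in> {1..n}" for i
      using xi_rv \<open>n \<ge> 1\<close> that .
    note distr = same_distr[OF \<open>n \<ge> 1\<close>]
    define G where "G = {\<omega> \<in> space (M n). graphical n (parity_corrected n (\<lambda>i. \<xi> n i \<omega>))}"
    define B where "B = {\<omega> \<in> space (M n). 
      (\<Sum>i=1..n. if \<xi> n i \<omega> > real a then \<xi> n i \<omega> else 0) \<ge> 2 * (1 / 16) * card {1..n}}"
    have G: "G \<in> events" unfolding G_def by (rule sets_graphical_parity_corrected) (rule \<xi>)
    have B: "B \<in> events" unfolding B_def by measurable
    have int: "integrable (M n) (\<lambda>\<omega>. \<xi> n i \<omega> powr \<delta>)"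
      and moment: "expectation (\<lambda>\<omega>. \<xi> n i \<omega> powr \<delta>) = K" if "i \<in> {1..n}" for i
    proof -
      have "integrable (distr (M n) borel (\<xi> n i)) (\<lambda>x. x powr \<delta>)"
        unfolding distr[OF that] using X_int X_rv by (simp add: integrable_distr_eq)
      then show "integrable (M n) (\<lambda>\<omega>. \<xi> n i \<omega> powr \<delta>)"
        using \<xi>[OF that] by (simp add: integrable_distr_eq)
      have "expectation (\<lambda>\<omega>. \<xi> n i \<omega> powr \<delta>) = (\<integral>x. x powr \<delta> \<partial>distr (M n) borel (\<xi> n i))"
        using \<xi>[OF that] by (simp add: integral_distr)
      also have "\<dots> = K" unfolding distr[OF that] K_def using X_rv by (simp add: integral_distr)
      finally show "expectation (\<lambda>\<omega>. \<xi> n i \<omega> powr \<delta>) = K" .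
    qed
    have "prob B \<le> K * (1 + 1 / (1 / 16)\<^sup>2) * card {1..n} powr (1 - \<delta>)"
      unfolding B_def
    proof (rule large_summands_deviation)
      show "indep_vars (\<lambda>_. borel) (\<xi> n) {1..n}" using xi_indep \<open>n \<ge> 1\<close> .
    qed (use int moment a gamma delta \<open>n \<ge> 1\<close> in auto)
    then have prob_B: "prob B \<le> K * 257 * real n powr (1 - \<delta>)" by (simp add: power2_eq_square)
    have "AE \<omega> in M n. \<exists>k::nat. k \<ge> 1 \<and> \<xi> n i \<omega> = real k" if "i \<in> {1..n}" for i
    proof -
      have "AE x in distr (M n) borel (\<xi> n i). \<exists>k::nat. k \<ge> 1 \<and> x = real k"
        unfolding distr[OF that] using X_pos_int X_rv by (subst AE_distr_iff) auto
      then show ?thesis using \<xi>[OF that] by (subst (asm) AE_distr_iff) auto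
    qed
    then have "AE \<omega> in M n. \<forall>i\<in>{1..n}. \<exists>k::nat. k \<ge> 1 \<and> \<xi> n i \<omega> = real k"
      by (intro AE_finite_allI) auto
    then have "AE \<omega> in M n. \<omega> \<in> space (M n) - B \<longrightarrow> \<omega> \<in> G"
    proof eventually_elim
      case (elim \<omega>)
      show ?case
      proof
        assume "\<omega> \<in> space (M n) - B"
        then have "8 * (\<Sum>i=1..n. if \<xi> n i \<omega> > real a then \<xi> n i \<omega> else 0) \<le> real n" "\<omega> \<in> space (M n)"
          by (auto simp: B_def)
        then show "\<omega> \<in> G"
          unfolding G_def using graphical_parity_corrected[OF _ _ n, of "\<lambda>i. \<xi> n i \<omega>"] elim by blast
      qed
    qed
    then have "prob (space (M n) - B) \<le> prob G" using G by (rule finite_measure_mono_AE)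
    then have "1 - prob G \<le> K * 257 * real n powr (1 - \<delta>)" 
      using prob_compl[OF B] prob_B by linarith
    then show ?thesis using prob_le_1[of G] unfolding G_def[symmetric] by simp
  qed
  show ?thesis
    by (rule bigoI[of _ "K * 257"]) 
      (use bound in \<open>auto intro: eventually_mono[OF eventually_gt_at_top[of "10 * (a + 1)\<^sup>2"]]\<close>)
qed

end
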